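(* Let $k\ge 2$, $p\ge 0$ and $\mu\ge 0$ be integers. Let $a_1,a_2,\dots,a_k$ be positive integers with $\gcd(a_1,a_2,\dots,a_k)=1$ and $a_1=\min_{1\le i\le k}a_i$, and let $\{m_0^{(p)},m_1^{(p)},\dots,m_{a_1-1}^{(p)}\}$ be the $p$-Apéry set of $\{a_1,\dots,a_k\}$. Let $\lambda$ be a complex number with $\lambda^{a_1}\ne 1$. Then \begin{align*} \sum_{\substack{n\in\mathbb N_0\\ d(n)\le p}}\lambda^n n^\mu &=\sum_{n=0}^\mu\frac{(-a_1)^n}{(\lambda^{a_1}-1)^{n+1}}\binom{\mu}{n}\sum_{j=0}^n\left\langle {n\atop n-j}\right\rangle\lambda^{ja_1}\sum_{i=0}^{a_1-1}\bigl(m_i^{(p)}\bigr)^{\mu-n}\lambda^{m_i^{(p)}}\\ &\quad+\frac{(-1)^{\mu+1}}{(\lambda-1)^{\mu+1}}\sum_{j=0}^\mu\left\langle {\mu\atop \mu-j}\right\rangle\lambda^j , \end{align*} where $\left\langle {n\atop m}\right\rangle$ are the Eulerian numbers and $0^0=1$.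
   Context: $\mathbb N_0$ denotes the set of non-negative integers. For positive integers $a_1,\dots,a_k$ and $n\in\mathbb N_0$, the denumerant is $$d(n)=d(n;a_1,\dots,a_k)=\#\{(x_1,\dots,x_k)\in\mathbb N_0^k : n=x_1a_1+\cdots+x_ka_k\}.$$ For an integer $p\ge 0$ put $S_p=S_p(a_1,\dots,a_k)=\{n\in\mathbb N_0 : d(n)>p\}$. The $p$-Apéry set of $\{a_1,\dots,a_k\}$ is $\{m_0^{(p)},m_1^{(p)},\dots,m_{a_1-1}^{(p)}\}$, where for $0\le i\le a_1-1$ the non-negative integer $m_i^{(p)}$ is uniquely determined by: (1) $m_i^{(p)}\equiv i\pmod{a_1}$; (2) $m_i^{(p)}\in S_p$; (3) $m_i^{(p)}-a_1\notin S_p$. The Eulerian numbers are, for $0\le m\le n$, $$\left\langle {n\atop m}\right\rangle=\sum_{k=0}^{m}(-1)^k\binom{n+1}{k}(m-k+1)^n,$$ so $\left\langle {0\atop 0}\right\rangle=1$ and $\left\langle {n\atop n}\right\rangle=0$ for $n\ge1$; for $n\ge 1$ they satisfy $\sum_{k=0}^\infty k^nx^k=\frac{1}{(1-x)^{n+1}}\sum_{m=0}^{n-1}\left\langle {n\atop m}\right\rangle x^{m+1}$. The convention $0^0=1$ is used throughout. *)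

theory Defs
  imports Complex_Main "HOL-Library.FuncSet" "HOL-Number_Theory.Cong"
begin

text \<open>A tuple \<open>a\<^sub>1, \<dots>, a\<^sub>k\<close> is a function on \<open>nat\<close> of which only the values at \<open>{1..k}\<close> matter;
  \<open>{1..k} \<rightarrow>\<^sub>E UNIV\<close> has exactly one element for each tuple in \<open>\<nat>\<^sub>0\<^sup>k\<close>.\<close>

definition representations :: "nat \<Rightarrow> (nat \<Rightarrow> nat) \<Rightarrow> nat \<Rightarrow> (nat \<Rightarrow> nat) set" where
  "representations k a n = {x \<in> {1..k} \<rightarrow>\<^sub>E UNIV. n = (\<Sum>i=1..k. x i * a i)}"

definition denumerant :: "nat \<Rightarrow> (nat \<Rightarrow> nat) \<Rightarrow> nat \<Rightarrow> nat" where
  "denumerant k a n = card (representations k a n)"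

definition S_set :: "nat \<Rightarrow> nat \<Rightarrow> (nat \<Rightarrow> nat) \<Rightarrow> nat set" where
  "S_set p k a = {n. denumerant k a n > p}"

text \<open>The difference \<open>m - a\<^sub>1\<close> is taken in \<open>\<int>\<close>: truncated subtraction would be wrong for \<open>m < a\<^sub>1\<close>.\<close>

definition is_apery :: "nat \<Rightarrow> nat \<Rightarrow> (nat \<Rightarrow> nat) \<Rightarrow> nat \<Rightarrow> nat \<Rightarrow> bool" where
  "is_apery p k a i m \<longleftrightarrow>
     [m = i] (mod a 1) \<and> m \<in> S_set p k a \<and> int m - int (a 1) \<notin> int ` S_set p k a"

definition apery :: "nat \<Rightarrow> nat \<Rightarrow> (nat \<Rightarrow> nat) \<Rightarrow> nat \<Rightarrow> nat" where
  "apery p k a i = (THE m. is_apery p k a i m)"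

definition eulerian :: "nat \<Rightarrow> nat \<Rightarrow> int" where
  "eulerian n m = (\<Sum>k=0..m. (-1) ^ k * int (Suc n choose k) * (int m - int k + 1) ^ n)"


text \<open>The cardinality, the description of \<open>apery\<close> and the sum over \<open>{n. denumerant k a n \<le> p}\<close>
  are meaningful: the sets involved are finite, and \<open>apery\<close> is uniquely determined.\<close>

lemma finite_representations:
  assumes "\<And>i. i \<in> {1..k} \<Longrightarrow> a i > 0"
  shows "finite (representations k a n)"
proof (rule finite_subset)
  show "representations k a n \<subseteq> {1..k} \<rightarrow>\<^sub>E {..n}"
  proof
    fix x assume x: "x \<in> representations k a n"
    have "x i \<le> n" if i: "i \<in> {1..k}" for i
    proof -
      have "x i \<le> x i * a i"
        using assms[OF i] by simp
      also have "\<dots> \<le> (\<Sum>i=1..k. x i * a i)"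
        by (rule member_le_sum) (use i in auto)
      finally show ?thesis
        using x by (simp add: representations_def)
    qed
    thus "x \<in> {1..k} \<rightarrow>\<^sub>E {..n}"
      using x by (auto simp: representations_def PiE_iff)
  qed
  show "finite ({1..k} \<rightarrow>\<^sub>E {..n})"
    by (intro finite_PiE) auto
qed

lemma Gcd_image_eq_sum:
  fixes a :: "nat \<Rightarrow> nat"
  assumes "finite A"
  shows "\<exists>c. (\<Sum>i\<in>A. c i * int (a i)) = int (Gcd (a ` A))"
  using assms
proof (induction A rule: finite_induct)
  case (insert j A)
  then obtain c where c: "(\<Sum>i\<in>A. c i * int (a i)) = int (Gcd (a ` A))"
    by blast
  obtain u v where uv: "u * int (a j) + v * int (Gcd (a ` A)) = gcd (int (a j)) (int (Gcd (a ` A)))"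
    using bezout_int by blast
  define c' where "c' = (\<lambda>i. if i = j then u else v * c i)"
  have "(\<Sum>i\<in>insert j A. c' i * int (a i)) = u * int (a j) + (\<Sum>i\<in>A. v * (c i * int (a i)))"
    using insert.hyps by (auto simp: c'_def intro!: sum.cong)
  also have "\<dots> = int (Gcd (a ` insert j A))"
    using uv c by (simp add: sum_distrib_left[symmetric])
  finally show ?case
    by blast
qed simp

lemma denumerant_large:
  fixes a :: "nat \<Rightarrow> nat"
  assumes k: "k \<ge> 2" and pos: "\<And>i. i \<in> {1..k} \<Longrightarrow> a i > 0"
    and gcd: "Gcd (a ` {1..k}) = 1"
    and n: "n \<ge> (\<Sum>i=2..k. (p + 1) * a 1 * a i)"
  shows "denumerant k a n > p"
proof -
  obtain c where c: "(\<Sum>i=1..k. c i * int (a i)) = 1"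
    using Gcd_image_eq_sum[of "{1..k}" a] gcd by auto
  have a1: "a 1 > 0"
    using pos k by simp
  have split: "{1..k} = insert 1 {2..k}"
    using k by auto
  define r where "r i = nat ((int n * c i) mod int (a 1))" for i
  have r_lt: "r i < a 1" and r_cong: "[int (r i) = int n * c i] (mod int (a 1))" for i
    using a1 by (simp_all add: r_def nat_less_iff cong_def)
  define x where "x t i = r i + (if i = 2 then t * a 1 else 0)" for t i :: nat
  define s where "s t = (\<Sum>i=2..k. x t i * a i)" for t
  define y where "y t = restrict ((x t)(1 := (n - s t) div a 1)) {1..k}" for t
  have y_rep: "y t \<in> representations k a n" if t: "t \<le> p" for t
  proof -
    have "x t i \<le> (p + 1) * a 1" for i
    proof -
      have "t * a 1 \<le> p * a 1"
        using t by simp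
      hence "x t i \<le> a 1 + p * a 1"
        unfolding x_def using r_lt[of i] by (intro add_mono) auto
      thus ?thesis
        by simp
    qed
    hence "s t \<le> (\<Sum>i=2..k. (p + 1) * a 1 * a i)"
      unfolding s_def by (intro sum_mono mult_right_mono) auto
    hence s_le: "s t \<le> n"
      using n by simp
    have x_cong: "[int (x t i) = int n * c i] (mod int (a 1))" for i
      using cong_add[OF r_cong[of i], of "int (if i = 2 then t * a 1 else 0)" 0]
      by (auto simp: x_def cong_def)
    have "[int (s t) = (\<Sum>i=2..k. int n * c i * int (a i))] (mod int (a 1))"
      unfolding s_def of_nat_sum of_nat_mult by (intro cong_sum cong_mult x_cong cong_refl)
    also have "[(\<Sum>i=2..k. int n * c i * int (a i)) =
        int n * c 1 * int (a 1) + (\<Sum>i=2..k. int n * c i * int (a i))] (mod int (a 1))"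
      by (simp add: cong_def)
    also have "int n * c 1 * int (a 1) + (\<Sum>i=2..k. int n * c i * int (a i)) =
        int n * (\<Sum>i=1..k. c i * int (a i))"
      unfolding split by (simp add: sum_distrib_left algebra_simps)
    also have "\<dots> = int n"
      using c by simp
    finally have "[s t = n] (mod a 1)"
      by (simp add: cong_int_iff)
    hence "a 1 dvd n - s t"
      using s_le by (metis cong_altdef_nat cong_sym)
    hence "(n - s t) div a 1 * a 1 + s t = n"
      using s_le by simp
    moreover have "(\<Sum>i=1..k. y t i * a i) = (n - s t) div a 1 * a 1 + s t"
    proof -
      have "(\<Sum>i=2..k. y t i * a i) = s t"
        unfolding s_def y_def by (intro sum.cong) auto
      moreover have "y t 1 = (n - s t) div a 1"
        using k by (simp add: y_def)
      ultimately show ?thesis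
        unfolding split by simp
    qed
    ultimately show ?thesis
      by (simp add: representations_def y_def)
  qed
  have "inj_on y {..p}"
  proof (rule inj_onI)
    fix t u assume "y t = y u"
    hence "y t 2 = y u 2"
      by simp
    thus "t = u"
      using k a1 by (simp add: y_def x_def)
  qed
  hence "card (y ` {..p}) = p + 1"
    by (simp add: card_image)
  moreover have "card (y ` {..p}) \<le> denumerant k a n"
    unfolding denumerant_def
    using y_rep pos by (intro card_mono finite_representations) auto
  ultimately show ?thesis
    by simp
qed

lemma finite_denumerant_le:
  fixes a :: "nat \<Rightarrow> nat"
  assumes "k \<ge> 2" and "\<And>i. i \<in> {1..k} \<Longrightarrow> a i > 0" and "Gcd (a ` {1..k}) = 1"
  shows "finite {n. denumerant k a n \<le> p}"
proof (rule finite_subset)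
  show "{n. denumerant k a n \<le> p} \<subseteq> {..<(\<Sum>i=2..k. (p + 1) * a 1 * a i)}"
    using denumerant_large[OF assms] by (force simp: not_le[symmetric])
qed simp

lemma S_set_add:
  fixes a :: "nat \<Rightarrow> nat"
  assumes k: "k \<ge> 1" and pos: "\<And>i. i \<in> {1..k} \<Longrightarrow> a i > 0"
    and n: "n \<in> S_set p k a"
  shows "n + q * a 1 \<in> S_set p k a"
proof -
  have split: "{1..k} = insert 1 {2..k}"
    using k by auto
  have mem: "x(1 := x 1 + q) \<in> representations k a (n + q * a 1)"
    if "x \<in> representations k a n" for x
  proof -
    have "(\<Sum>i=2..k. (x(1 := x 1 + q)) i * a i) = (\<Sum>i=2..k. x i * a i)"
      by (intro sum.cong) auto
    thus ?thesis
      using that unfolding representations_def split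
      by (auto simp: algebra_simps PiE_iff extensional_def)
  qed
  have inj: "inj_on (\<lambda>x. x(1 := x 1 + q)) (representations k a n)"
  proof (rule inj_onI, rule ext)
    fix x y :: "nat \<Rightarrow> nat" and i
    assume eq: "x(1 := x 1 + q) = y(1 := y 1 + q)"
    show "x i = y i"
      using fun_cong[OF eq, of i] by (simp split: if_splits)
  qed
  have "denumerant k a n \<le> denumerant k a (n + q * a 1)"
    unfolding denumerant_def
    by (rule card_inj_on_le[OF inj]) (use mem pos finite_representations in auto)
  thus ?thesis
    using n by (simp add: S_set_def)
qed

lemma ex1_is_apery:
  fixes a :: "nat \<Rightarrow> nat"
  assumes k: "k \<ge> 2" and pos: "\<And>i. i \<in> {1..k} \<Longrightarrow> a i > 0"
    and gcd: "Gcd (a ` {1..k}) = 1"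
  shows "\<exists>!m. is_apery p k a i m"
proof (rule ex_ex1I)
  have a1: "a 1 > 0"
    using pos k by simp
  define B where "B = (\<Sum>i=2..k. (p + 1) * a 1 * a i)"
  define P where "P m \<longleftrightarrow> [m = i] (mod a 1) \<and> m \<in> S_set p k a" for m
  have "B \<le> i + B * a 1"
    using a1 by (simp add: trans_le_add2)
  hence "P (i + B * a 1)"
    using denumerant_large[OF k pos gcd, of p "i + B * a 1"]
    by (simp add: P_def S_set_def B_def cong_def)
  hence least: "P (LEAST m. P m)"
    by (rule LeastI)
  define m where "m = (LEAST m. P m)"
  have "int m - int (a 1) \<notin> int ` S_set p k a"
  proof
    assume "int m - int (a 1) \<in> int ` S_set p k a"
    then obtain l where l: "l \<in> S_set p k a" "m = l + a 1"
      by force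
    moreover have "P m"
      using least by (simp only: m_def)
    ultimately have "P l"
      by (simp add: P_def cong_def)
    hence "m \<le> l"
      unfolding m_def by (rule Least_le)
    thus False
      using l a1 by simp
  qed
  thus "\<exists>m. is_apery p k a i m"
    using least by (auto simp: is_apery_def P_def m_def)
next
  have less: False if "is_apery p k a i m" "is_apery p k a i m'" "m < m'" for m m'
  proof -
    have "[m' = m] (mod a 1)"
      using that by (auto simp: is_apery_def cong_def)
    hence "a 1 dvd m' - m"
      using that(3) by (simp add: cong_altdef_nat)
    then obtain q where q: "m' - m = a 1 * q"
      by blast
    have "q > 0"
      using q that(3) by (cases q) auto
    then obtain q' where "q = Suc q'"
      using gr0_implies_Suc by blast
    hence m': "m' = (m + q' * a 1) + a 1"
      using q that(3) by (simp add: algebra_simps)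
    have "m + q' * a 1 \<in> S_set p k a"
      using S_set_add[of k a m p q'] k pos that(1) by (simp add: is_apery_def)
    moreover have "int m' - int (a 1) = int (m + q' * a 1)"
      using m' by simp
    ultimately show False
      using that(2) unfolding is_apery_def by (metis imageI)
  qed
  show "m = m'" if "is_apery p k a i m" "is_apery p k a i m'" for m m'
    using less that by (meson linorder_neqE_nat)
qed

lemma is_apery_apery:
  fixes a :: "nat \<Rightarrow> nat"
  assumes "k \<ge> 2" and "\<And>i. i \<in> {1..k} \<Longrightarrow> a i > 0" and "Gcd (a ` {1..k}) = 1"
  shows "is_apery p k a i (apery p k a i)"
  unfolding apery_def by (rule theI', rule ex1_is_apery[OF assms])

end

theory Submission
  imports Defs "HOL-Computational_Algebra.Formal_Power_Series"
begin

text \<open>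
  Everything is read off from one identity of formal power series in \<open>t\<close>. Put
  \<open>z = \<lambda> e\<^sup>t\<close>, so that \<open>\<mu>!\<close> times the coefficient of \<open>t\<^sup>\<mu>\<close> in \<open>z\<^sup>n\<close>
  is the summand \<open>\<lambda>\<^sup>n n\<^sup>\<mu>\<close>. Let \<open>G\<close> be the finite set of those \<open>n\<close> that have at most \<open>p\<close>
  representations, and write \<open>b = a\<^sub>1\<close>. Within a residue class
  \<open>i\<close> modulo \<open>b\<close> the elements of \<open>G\<close> are \<open>i, i + b, \<dots>, m\<^sub>i - b\<close>, so summing geometric
  progressions (lemma \<open>sum_gaps_times_power_minus_one\<close>) gives
  \<open>\<Sum>\<^bsub>n \<in> G\<^esub> z\<^sup>n = (\<Sum>\<^sub>i z\<^bsup>m\<^sub>i\<^esup>) / (z\<^sup>b - 1) - 1 / (z - 1)\<close>.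
  The quotients exist because the constant terms \<open>\<lambda>\<^sup>b - 1\<close> and \<open>\<lambda> - 1\<close> do not vanish.

  The Eulerian numbers enter through \<open>1 / (y e\<^bsup>dt\<^esup> - 1)\<close>. With \<open>E = e\<^bsup>-dt\<^esup>\<close>, the divided
  difference \<open>((y - 1)\<^bsup>n+1\<^esup> - (E - 1)\<^bsup>n+1\<^esup>) / (y - E)\<close> of the polynomial \<open>(X - 1)\<^bsup>n+1\<^esup>\<close> is a
  polynomial in \<open>y\<close> and \<open>E\<close> whose coefficients are the signed binomials that define the Eulerian
  numbers. As \<open>(E - 1)\<^bsup>n+1\<^esup>\<close> is divisible by \<open>t\<^bsup>n+1\<^esup>\<close>, it does not affect the coefficient of
  \<open>t\<^sup>n\<close>, and that coefficient of \<open>1 / (y e\<^bsup>dt\<^esup> - 1)\<close> comes out as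
  \<open>(-d)\<^sup>n / (n! (y - 1)\<^bsup>n+1\<^esup>) * \<Sum>\<^sub>j \<langle>n, n-j\<rangle> y\<^sup>j\<close> (lemma \<open>fps_nth_inverse_exp\<close>). Taking
  \<open>d = b, y = \<lambda>\<^sup>b\<close> and \<open>d = 1, y = \<lambda>\<close> yields the two terms of the formula, the binomial
  coefficients coming from the Cauchy product.
\<close>

section \<open>Eulerian numbers as coefficients of an exponential generating function\<close>

text \<open>The divided difference of \<open>(X - 1)\<^bsup>n+1\<^esup>\<close> at the points \<open>y\<close> and \<open>E\<close>: expand by the binomial
  theorem and divide each difference \<open>y\<^bsup>n+1-k\<^esup> - E\<^bsup>n+1-k\<^esup>\<close> by \<open>y - E\<close>.\<close>

lemma divided_difference_power_minus_one:
  fixes y E :: "'a :: comm_ring_1"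
  shows "(y - E) * (\<Sum>j=0..n. y ^ j * (\<Sum>k=0..n-j. (-1) ^ k * of_nat (Suc n choose k) * E ^ (n - j - k)))
    = (y - 1) ^ Suc n - (E - 1) ^ Suc n"
proof -
  have expand: "(x - 1) ^ Suc n = (\<Sum>k\<le>Suc n. (-1) ^ k * of_nat (Suc n choose k) * x ^ (Suc n - k))"
    for x :: 'a
    using binomial_ring[of "-1" x "Suc n"] by (simp add: mult_ac add_ac)
  have "(y - 1) ^ Suc n - (E - 1) ^ Suc n =
      (\<Sum>k\<le>Suc n. (-1) ^ k * of_nat (Suc n choose k) * (y ^ (Suc n - k) - E ^ (Suc n - k)))"
    unfolding expand by (simp add: sum_subtractf algebra_simps del: sum.atMost_Suc)
  also have "\<dots> = (\<Sum>k\<le>Suc n. \<Sum>j<Suc n - k.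
      (y - E) * (y ^ j * ((-1) ^ k * of_nat (Suc n choose k) * E ^ (n - j - k))))"
  proof (rule sum.cong[OF refl])
    fix k
    have "y ^ (Suc n - k) - E ^ (Suc n - k) = (y - E) * (\<Sum>j<Suc n - k. E ^ (Suc n - k - Suc j) * y ^ j)"
      by (rule power_diff_sumr2)
    also have "\<dots> = (y - E) * (\<Sum>j<Suc n - k. E ^ (n - j - k) * y ^ j)"
      by (intro arg_cong[where f = "(*) (y - E)"] sum.cong refl) (simp add: add.commute)
    finally show "(-1) ^ k * of_nat (Suc n choose k) * (y ^ (Suc n - k) - E ^ (Suc n - k)) =
        (\<Sum>j<Suc n - k. (y - E) * (y ^ j * ((-1) ^ k * of_nat (Suc n choose k) * E ^ (n - j - k))))"
      by (simp add: sum_distrib_left mult_ac)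
  qed
  also have "\<dots> = (\<Sum>j=0..n. \<Sum>k=0..n-j.
      (y - E) * (y ^ j * ((-1) ^ k * of_nat (Suc n choose k) * E ^ (n - j - k))))"
    unfolding sum.Sigma[OF finite_atMost ballI[OF finite_lessThan]]
      sum.Sigma[OF finite_atLeastAtMost ballI[OF finite_atLeastAtMost]]
    by (rule sum.reindex_bij_witness[where i = prod.swap and j = prod.swap]) auto
  finally show ?thesis
    by (simp add: sum_distrib_left)
qed

text \<open>Apply the divided difference at \<open>E = e\<^bsup>-dt\<^esup>\<close>. Multiplied by a further factor \<open>E\<close>, its quotient has
  the terms \<open>E\<^bsup>n-j-k+1\<^esup>\<close>, whose coefficients of \<open>t\<^sup>n\<close> are the powers \<open>(n-j-k+1)\<^sup>n\<close> in the definition of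
  \<open>eulerian n (n - j)\<close>, up to the factor \<open>(-d)\<^sup>n / n!\<close>.\<close>

lemma fps_nth_inverse_exp:
  fixes y d :: "'a :: field_char_0"
  assumes "y \<noteq> 1"
  shows "fps_nth (inverse (fps_const y * fps_exp d - 1)) n =
    (- d) ^ n / (fact n * (y - 1) ^ (n + 1)) * (\<Sum>j=0..n. of_int (eulerian n (n - j)) * y ^ j)"
proof -
  define E where "E = fps_exp (- d)"
  define B where "B = (\<Sum>j=0..n. fps_const y ^ j *
    (\<Sum>k=0..n-j. (-1) ^ k * of_nat (Suc n choose k) * E ^ (n - j - k)))"
  define D where "D = fps_const y * fps_exp d - 1"
  have D: "inverse D * D = 1"
    using assms by (intro inverse_mult_eq_1) (simp add: D_def)
  have DE: "D * E = fps_const y - E"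
    using fps_exp_add_mult[of d "- d"] by (simp add: D_def E_def algebra_simps)
  have const_power: "fps_const ((y - 1) ^ Suc n) = (fps_const y - 1) ^ Suc n"
    by (simp only: fps_const_power[symmetric] fps_const_sub[symmetric] fps_const_1_eq_1)
  have "D * (E * B) = (fps_const y - 1) ^ Suc n - (E - 1) ^ Suc n"
    using DE divided_difference_power_minus_one[of "fps_const y" E n]
    by (simp only: B_def mult.assoc[symmetric])
  hence "inverse D * D * (E * B) = inverse D * ((fps_const y - 1) ^ Suc n - (E - 1) ^ Suc n)"
    by (simp only: mult.assoc)
  hence "E * B = fps_const ((y - 1) ^ Suc n) * inverse D - (E - 1) ^ Suc n * inverse D"
    unfolding D const_power by (simp only: mult_1_left right_diff_distrib mult.commute)
  \<comment> \<open>\<open>E - 1\<close> has no constant term, so its \<open>(n+1)\<close>-st power is invisible in degree \<open>n\<close>.\<close>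
  moreover have "fps_nth ((E - 1) ^ Suc n * inverse D) n = 0"
  proof -
    have "fps_nth ((E - 1) ^ Suc n) i = 0" if "i \<le> n" for i
      using startsby_zero_power_prefix[of "E - 1" "Suc n"] that by (simp add: E_def)
    thus ?thesis
      by (simp add: fps_mult_nth del: power_Suc)
  qed
  ultimately have coeff: "fps_nth (E * B) n = (y - 1) ^ Suc n * fps_nth (inverse D) n"
    by (simp del: power_Suc)
  have "E * B = (\<Sum>j=0..n. \<Sum>k=0..n-j.
      fps_const (y ^ j * ((-1) ^ k * of_nat (Suc n choose k))) * fps_exp (- d * of_nat (n - j - k + 1)))"
    unfolding B_def sum_distrib_left
  proof (intro sum.cong refl)
    fix j k
    have "E * E ^ (n - j - k) = fps_exp (- d * of_nat (n - j - k + 1))"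
      by (simp add: E_def fps_exp_power_mult algebra_simps flip: fps_exp_add_mult)
    moreover have "fps_const (y ^ j * ((-1) ^ k * of_nat (Suc n choose k))) =
        fps_const y ^ j * ((-1) ^ k * of_nat (Suc n choose k))"
      by (simp only: fps_const_mult[symmetric] fps_const_power[symmetric] fps_const_neg[symmetric]
          fps_const_1_eq_1 fps_of_nat)
    ultimately show "E * (fps_const y ^ j * ((-1) ^ k * of_nat (Suc n choose k) * E ^ (n - j - k))) =
        fps_const (y ^ j * ((-1) ^ k * of_nat (Suc n choose k))) * fps_exp (- d * of_nat (n - j - k + 1))"
      by (metis (no_types, lifting) mult.assoc mult.left_commute)
  qed
  hence "fps_nth (E * B) n = (\<Sum>j=0..n. \<Sum>k=0..n-j.
      y ^ j * ((-1) ^ k * of_nat (Suc n choose k)) * ((- d * of_nat (n - j - k + 1)) ^ n / fact n))"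
    by (simp add: fps_sum_nth del: of_nat_Suc binomial_Suc_Suc)
  also have "\<dots> = (- d) ^ n / fact n * (\<Sum>j=0..n. of_int (eulerian n (n - j)) * y ^ j)"
    unfolding sum_distrib_left
  proof (rule sum.cong[OF refl])
    fix j
    have "of_int (eulerian n (n - j)) =
        (\<Sum>k=0..n-j. (-1) ^ k * of_nat (Suc n choose k) * of_nat (n - j - k + 1) ^ n :: 'a)"
      unfolding eulerian_def of_int_sum
    proof (rule sum.cong[OF refl])
      fix k assume "k \<in> {0..n - j}"
      hence "int (n - j) - int k + 1 = int (n - j - k + 1)"
        by simp
      thus "of_int ((-1) ^ k * int (Suc n choose k) * (int (n - j) - int k + 1) ^ n) =
          (-1) ^ k * of_nat (Suc n choose k) * (of_nat (n - j - k + 1) ^ n :: 'a)"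
        by (simp only: of_int_mult of_int_power of_int_minus of_int_1 of_int_of_nat_eq)
    qed
    thus "(\<Sum>k=0..n-j. y ^ j * ((-1) ^ k * of_nat (Suc n choose k)) *
        ((- d * of_nat (n - j - k + 1)) ^ n / fact n)) =
        (- d) ^ n / fact n * (of_int (eulerian n (n - j)) * y ^ j)"
      by (simp only: power_mult_distrib sum_distrib_left sum_distrib_right times_divide_eq_right
          times_divide_eq_left mult_ac)
  qed
  finally have "(y - 1) ^ Suc n * fps_nth (inverse D) n =
      (- d) ^ n / fact n * (\<Sum>j=0..n. of_int (eulerian n (n - j)) * y ^ j)"
    by (simp only: coeff)
  moreover have "(y - 1) ^ Suc n \<noteq> 0"
    using assms by simp
  ultimately show ?thesis
    by (simp add: D_def field_simps del: power_Suc)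
qed

section \<open>The power sum over the integers with few representations\<close>

text \<open>This describes the Apery set without reference to residue classes, so that sums over \<open>i\<close>
  become sums over a set that can be compared with shifts of the gaps.\<close>

lemma apery_bij_betw:
  fixes a :: "nat \<Rightarrow> nat"
  assumes k: "k \<ge> 2" and pos: "\<And>i. i \<in> {1..k} \<Longrightarrow> a i > 0" and gcd: "Gcd (a ` {1..k}) = 1"
  shows "bij_betw (apery p k a) {..<a 1}
    {m \<in> S_set p k a. int m - int (a 1) \<notin> int ` S_set p k a}"
proof -
  note ap = is_apery_apery[OF k pos gcd, of p]
  have a1: "a 1 > 0"
    using pos k by simp
  have "inj_on (apery p k a) {..<a 1}"
  proof (rule inj_onI)
    fix i j assume "i \<in> {..<a 1}" "j \<in> {..<a 1}" "apery p k a i = apery p k a j"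
    thus "i = j"
      using ap[of i] ap[of j] by (auto simp: is_apery_def cong_def)
  qed
  moreover have "m \<in> apery p k a ` {..<a 1}"
    if m: "m \<in> S_set p k a" "int m - int (a 1) \<notin> int ` S_set p k a" for m
  proof -
    have "is_apery p k a (m mod a 1) m"
      using m by (simp add: is_apery_def cong_def)
    hence "m = apery p k a (m mod a 1)"
      using ex1_is_apery[OF k pos gcd] ap by blast
    thus ?thesis
      using a1 by auto
  qed
  ultimately show ?thesis
    using ap by (auto simp: bij_betw_def is_apery_def)
qed

text \<open>Call the \<open>n\<close> outside \<open>S_set\<close> gaps. Since \<open>S_set\<close> is closed under adding \<open>a\<^sub>1\<close>, the gaps and the
  Apery elements together are the numbers below \<open>a\<^sub>1\<close> together with the gaps shifted by \<open>a\<^sub>1\<close>; both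
  unions are disjoint. Summing \<open>z\<^sup>n\<close> over this set in the two ways gives the sums of the geometric
  progressions of gaps without any division.\<close>

lemma sum_gaps_times_power_minus_one:
  fixes a :: "nat \<Rightarrow> nat" and z :: "'a :: comm_ring_1"
  assumes k: "k \<ge> 2" and pos: "\<And>i. i \<in> {1..k} \<Longrightarrow> a i > 0" and gcd: "Gcd (a ` {1..k}) = 1"
  shows "(\<Sum>n | denumerant k a n \<le> p. z ^ n) * (z ^ a 1 - 1) =
    (\<Sum>i<a 1. z ^ apery p k a i) - (\<Sum>i<a 1. z ^ i)"
proof -
  define G where "G = {n. denumerant k a n \<le> p}"
  define M where "M = {m \<in> S_set p k a. int m - int (a 1) \<notin> int ` S_set p k a}"
  have bij: "bij_betw (apery p k a) {..<a 1} M"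
    unfolding M_def by (rule apery_bij_betw[OF k pos gcd])
  have fin: "finite G" "finite M"
    using finite_denumerant_le[OF k pos gcd] bij_betw_finite[OF bij] by (auto simp: G_def)
  have G: "n \<in> G \<longleftrightarrow> n \<notin> S_set p k a" for n
    by (simp add: G_def S_set_def not_less)
  have M: "m \<in> M \<longleftrightarrow> m \<in> S_set p k a \<and> (m < a 1 \<or> m - a 1 \<in> G)" for m
  proof (cases "m < a 1")
    case False
    hence "int m - int (a 1) = int (m - a 1)"
      by simp
    hence "int m - int (a 1) \<in> int ` S_set p k a \<longleftrightarrow> m - a 1 \<in> S_set p k a"
      by (metis (no_types, lifting) image_iff of_nat_eq_iff)
    thus ?thesis
      using False G by (simp add: M_def)
  qed (auto simp: M_def)
  have shift: "n - a 1 \<in> G" if "n \<in> G" "n \<ge> a 1" for n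
    using S_set_add[of k a "n - a 1" p 1] k pos that G by auto
  have "G \<union> M = {..<a 1} \<union> (\<lambda>n. n + a 1) ` G"
  proof (intro set_eqI)
    fix n
    have "n \<in> (\<lambda>n. n + a 1) ` G \<longleftrightarrow> n \<ge> a 1 \<and> n - a 1 \<in> G"
      by (auto simp: image_iff intro: bexI[of _ "n - a 1"])
    thus "n \<in> G \<union> M \<longleftrightarrow> n \<in> {..<a 1} \<union> (\<lambda>n. n + a 1) ` G"
      using shift[of n] M[of n] G[of n] by auto
  qed
  hence "(\<Sum>n\<in>G \<union> M. z ^ n) = (\<Sum>n\<in>{..<a 1} \<union> (\<lambda>n. n + a 1) ` G. z ^ n)"
    by simp
  also have "(\<Sum>n\<in>G \<union> M. z ^ n) = (\<Sum>n\<in>G. z ^ n) + (\<Sum>m\<in>M. z ^ m)"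
    using fin G by (intro sum.union_disjoint) (auto simp: M_def)
  also have "(\<Sum>m\<in>M. z ^ m) = (\<Sum>i<a 1. z ^ apery p k a i)"
    using sum.reindex_bij_betw[OF bij, of "\<lambda>m. z ^ m"] by simp
  also have "(\<Sum>n\<in>{..<a 1} \<union> (\<lambda>n. n + a 1) ` G. z ^ n) =
      (\<Sum>i<a 1. z ^ i) + (\<Sum>n\<in>(\<lambda>n. n + a 1) ` G. z ^ n)"
    using fin by (intro sum.union_disjoint) auto
  also have "(\<Sum>n\<in>(\<lambda>n. n + a 1) ` G. z ^ n) = (\<Sum>n\<in>G. z ^ n) * z ^ a 1"
    by (subst sum.reindex) (auto simp: power_add sum_distrib_right)
  finally show ?thesis
    unfolding G_def by (simp add: algebra_simps)
qed

theorem theorem2: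
  fixes k p \<mu> :: nat and a :: "nat \<Rightarrow> nat" and lam :: complex
  assumes "k \<ge> 2"
    and "\<And>i. i \<in> {1..k} \<Longrightarrow> a i > 0"
    and "Gcd (a ` {1..k}) = 1"
    and "a 1 = Min (a ` {1..k})"
    and "lam ^ a 1 \<noteq> 1"
  shows "(\<Sum>n | denumerant k a n \<le> p. lam ^ n * of_nat n ^ \<mu>) =
    (\<Sum>n=0..\<mu>. (- of_nat (a 1)) ^ n / (lam ^ a 1 - 1) ^ (n + 1) * of_nat (\<mu> choose n) *
       (\<Sum>j=0..n. of_int (eulerian n (n - j)) * lam ^ (j * a 1) *
          (\<Sum>i=0..a 1 - 1. of_nat (apery p k a i) ^ (\<mu> - n) * lam ^ apery p k a i)))
    + (-1) ^ (\<mu> + 1) / (lam - 1) ^ (\<mu> + 1) *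
       (\<Sum>j=0..\<mu>. of_int (eulerian \<mu> (\<mu> - j)) * lam ^ j)"
proof -
  define m where "m = apery p k a"
  define b where "b = a 1"
  define G where "G = {n. denumerant k a n \<le> p}"
  \<comment> \<open>\<open>z = \<lambda> e\<^sup>t\<close>, while \<open>H\<close> and \<open>K\<close> produce the two terms of the right-hand side.\<close>
  define z where "z = fps_const lam * fps_exp 1"
  define H where "H = inverse (z ^ b - 1)"
  define K where "K = inverse (z - 1)"
  have lam: "lam ^ b \<noteq> 1" "lam \<noteq> 1"
    using assms(5) by (auto simp: b_def)
  have z_power: "z ^ n = fps_const (lam ^ n) * fps_exp (of_nat n)" for n
    by (simp add: z_def power_mult_distrib fps_exp_power_mult)
  have z_nth: "fact r * fps_nth (\<Sum>n\<in>A. z ^ f n) r = (\<Sum>n\<in>A. lam ^ f n * of_nat (f n) ^ r)"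
    for r and A :: "nat set" and f
    by (simp add: fps_sum_nth z_power sum_distrib_left)
  have H: "(z ^ b - 1) * H = 1"
    unfolding H_def by (rule inverse_mult_eq_1') (use lam in \<open>simp add: z_power\<close>)
  have K: "(z - 1) * K = 1"
    unfolding K_def by (rule inverse_mult_eq_1') (use lam in \<open>simp add: z_def\<close>)
  have "(\<Sum>i<b. z ^ i) = (\<Sum>i<b. z ^ i) * ((z - 1) * K)"
    by (simp add: K)
  also have "\<dots> = (z ^ b - 1) * K"
    using power_diff_1_eq[of z b] by (simp add: mult_ac)
  finally have geom: "(\<Sum>i<b. z ^ i) * H = K"
    using H by (metis mult.commute mult.left_commute mult_1_right)
  have "(\<Sum>n\<in>G. z ^ n) = (\<Sum>n\<in>G. z ^ n) * (z ^ b - 1) * H"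
    using H by (simp add: mult.assoc)
  also have "\<dots> = ((\<Sum>i<b. z ^ m i) - (\<Sum>i<b. z ^ i)) * H"
    using sum_gaps_times_power_minus_one[OF assms(1-3), where p = p and z = z] by (simp add: G_def b_def m_def)
  also have "\<dots> = H * (\<Sum>i<b. z ^ m i) - K"
    using geom by (simp add: algebra_simps)
  finally have main: "(\<Sum>n\<in>G. z ^ n) = H * (\<Sum>i<b. z ^ m i) - K" .
  have H_nth: "fps_nth H n = (- of_nat b) ^ n / (fact n * (lam ^ b - 1) ^ (n + 1)) *
      (\<Sum>j=0..n. of_int (eulerian n (n - j)) * lam ^ (j * b))" for n
    using fps_nth_inverse_exp[OF lam(1), of "of_nat b" n]
    by (simp add: H_def z_power power_mult[symmetric] mult.commute)
  have K_nth: "- (fact \<mu> * fps_nth K \<mu>) = (-1) ^ (\<mu> + 1) / (lam - 1) ^ (\<mu> + 1) *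
      (\<Sum>j=0..\<mu>. of_int (eulerian \<mu> (\<mu> - j)) * lam ^ j)"
    using fps_nth_inverse_exp[OF lam(2), of 1 \<mu>] by (simp add: K_def z_def)
  have "{0..b - 1} = {..<b}"
    using assms(1,2) by (force simp: b_def)
  \<comment> \<open>The Cauchy product; its factorials combine to \<open>\<mu> choose n\<close>.\<close>
  hence "fact \<mu> * fps_nth (H * (\<Sum>i<b. z ^ m i)) \<mu> =
      (\<Sum>n=0..\<mu>. (- of_nat b) ^ n / (lam ^ b - 1) ^ (n + 1) * of_nat (\<mu> choose n) *
       (\<Sum>j=0..n. of_int (eulerian n (n - j)) * lam ^ (j * b) *
          (\<Sum>i=0..b - 1. of_nat (m i) ^ (\<mu> - n) * lam ^ m i)))"
    unfolding fps_mult_nth sum_distrib_left[of "fact \<mu>"]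
  proof (intro sum.cong refl)
    fix n assume n: "n \<in> {0..\<mu>}"
    assume range: "{0..b - 1} = {..<b}"
    define P where "P = (\<Sum>i=0..b - 1. of_nat (m i) ^ (\<mu> - n) * lam ^ m i)"
    define Q where "Q = (\<Sum>j=0..n. of_int (eulerian n (n - j)) * lam ^ (j * b))"
    have "fact (\<mu> - n) * fps_nth (\<Sum>i<b. z ^ m i) (\<mu> - n) = P"
      unfolding z_nth P_def range by (simp add: mult.commute)
    hence "fps_nth (\<Sum>i<b. z ^ m i) (\<mu> - n) = P / fact (\<mu> - n)"
      by (simp add: field_simps)
    hence "fact \<mu> * (fps_nth H n * fps_nth (\<Sum>i<b. z ^ m i) (\<mu> - n)) =
        (- of_nat b) ^ n / (lam ^ b - 1) ^ (n + 1) * (fact \<mu> / (fact n * fact (\<mu> - n))) * (Q * P)"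
      unfolding H_nth Q_def by (simp add: mult_ac)
    also have "fact \<mu> / (fact n * fact (\<mu> - n)) = (of_nat (\<mu> choose n) :: complex)"
      using n by (simp add: binomial_fact)
    also have "Q * P = (\<Sum>j=0..n. of_int (eulerian n (n - j)) * lam ^ (j * b) * P)"
      by (simp add: Q_def sum_distrib_right)
    finally show "fact \<mu> * (fps_nth H n * fps_nth (\<Sum>i<b. z ^ m i) (\<mu> - n)) =
      (- of_nat b) ^ n / (lam ^ b - 1) ^ (n + 1) * of_nat (\<mu> choose n) *
       (\<Sum>j=0..n. of_int (eulerian n (n - j)) * lam ^ (j * b) *
          (\<Sum>i=0..b - 1. of_nat (m i) ^ (\<mu> - n) * lam ^ m i))"
      by (simp only: P_def)
  qed
  moreover have "(\<Sum>n\<in>G. lam ^ n * of_nat n ^ \<mu>) =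
      fact \<mu> * fps_nth (H * (\<Sum>i<b. z ^ m i)) \<mu> + - (fact \<mu> * fps_nth K \<mu>)"
    using z_nth[of \<mu> "\<lambda>n. n" G] main by (simp add: algebra_simps)
  ultimately show ?thesis
    unfolding K_nth by (simp only: G_def b_def m_def)
qed

end
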